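(* Let $d\ge1$. For a measure $\mu\in\mathcal M$, $$I(\mu)=\sup_{\gamma\in\mathcal M}I(\gamma)=\frac12$$ if and only if $\mu$ is centrally symmetric.
   Context: $\mathbb S^d\subset\mathbb R^{d+1}$ is the unit sphere, $d(x,y)=\frac1\pi\arccos(x\cdot y)$ is the normalized geodesic distance, $\mathcal M$ is the set of Borel probability measures on $\mathbb S^d$, and $I(\mu)=\int_{\mathbb S^d}\int_{\mathbb S^d}d(x,y)\,d\mu(x)\,d\mu(y)$. A measure $\mu$ is centrally symmetric if $\mu(E)=\mu(-E)$ for every Borel set $E\subset\mathbb S^d$. *)

theory Defs
  imports "HOL-Probability.Probability"
begin

text \<open>The sphere of dimension \<open>d\<close> is \<^term>\<open>sphere (0 :: real ^ 'n) 1\<close> with \<open>CARD('n) = d + 1\<close>.\<close>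

definition geodesic_dist :: "real ^ 'n \<Rightarrow> real ^ 'n \<Rightarrow> real" where
  "geodesic_dist x y = arccos (x \<bullet> y) / pi"

text \<open>The underlying space of these measures is the sphere, not the ambient Euclidean space;
  the condition on \<open>sets\<close> also determines the underlying space.\<close>

definition sphere_prob_measures :: "(real ^ 'n) measure set" where
  "sphere_prob_measures =
     {\<mu>. prob_space \<mu> \<and> sets \<mu> = sets (restrict_space borel (sphere 0 1))}"

definition geodesic_energy :: "(real ^ 'n) measure \<Rightarrow> real" where
  "geodesic_energy \<mu> = (LINT y|\<mu>. (LINT x|\<mu>. geodesic_dist x y))"

definition centrally_symmetric :: "(real ^ 'n) measure \<Rightarrow> bool" where
  "centrally_symmetric \<mu> \<longleftrightarrow>
     (\<forall>E \<in> sets borel. E \<subseteq> sphere 0 1 \<longrightarrow> emeasure \<mu> E = emeasure \<mu> (uminus ` E))"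

end

theory Submission
  imports Defs
begin

text \<open>On \<open>[-1, 1]\<close> we have \<open>arccos t = \<pi>/2 - (\<Sum>n. c n * t ^ n)\<close> with \<open>c n \<ge> 0\<close>, strictly for
  odd \<open>n\<close>. Expanding \<open>(x \<bullet> y) ^ n\<close> shows that its double integral is the sum of the squares of the
  moments of \<open>\<mu>\<close> of order \<open>n\<close>, so the energy is at most \<open>1/2\<close>, and equality forces every moment of
  odd order to vanish. Then \<open>\<mu>\<close> and its reflection agree on polynomials, hence by Stone-Weierstrass
  on continuous functions, hence as measures. Conversely, \<open>arccos (-t) = \<pi> - arccos t\<close> gives a
  centrally symmetric measure potential \<open>1/2\<close> at every point of the sphere.\<close>

section \<open>Power series of the inverse sine on the closed interval\<close>

text \<open>This is the binomial series with exponent -1/2 at \<open>- (t\<^sup>2)\<close>. Strict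
  positivity at even indices matters because integration moves it to the odd indices, where it later
  detects the odd moments.\<close>

lemma inverse_sqrt_power_series:
  obtains b :: "nat \<Rightarrow> real"
  where "\<And>n. b n \<ge> 0" and "\<And>n. even n \<Longrightarrow> b n > 0"
    and "\<And>t. \<bar>t\<bar> < 1 \<Longrightarrow> (\<lambda>n. b n * t ^ n) sums (1 / sqrt (1 - t\<^sup>2))"
proof -
  \<comment> \<open>The binomial coefficient of -1/2 over \<open>k\<close> is
    \<open>(-1) ^ k * a k\<close>; its sign cancels against that of
    \<open>(- (t\<^sup>2)) ^ k\<close>, leaving positive coefficients.\<close>
  define a :: "nat \<Rightarrow> real" where "a k = pochhammer (1 / 2) k / fact k" for k
  define b where "b n = (if even n then a (n div 2) else 0)" for n
  have a_pos: "a k > 0" for k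
    by (simp add: a_def pochhammer_pos)
  have "(\<lambda>n. b n * t ^ n) sums (1 / sqrt (1 - t\<^sup>2))" if t: "\<bar>t\<bar> < 1" for t
  proof -
    have t2: "t\<^sup>2 < 1"
      using t by (simp add: abs_square_less_1)
    have "(\<lambda>k. ((- (1/2)) gchoose k) * (- (t\<^sup>2)) ^ k) sums (1 + - (t\<^sup>2)) powr (- (1/2))"
      by (rule gen_binomial_real) (use t2 in simp)
    moreover have "((- (1/2)) gchoose k) * (- (t\<^sup>2)) ^ k = b (2 * k) * t ^ (2 * k)" for k
    proof -
      have "(- (t\<^sup>2)) ^ k = (-1) ^ k * t ^ (2 * k)"
        by (subst power_minus) (simp add: power_mult)
      then show ?thesis
        by (simp add: gbinomial_pochhammer a_def b_def flip: mult.assoc power_mult_distrib)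
    qed
    moreover have "(1 + - (t\<^sup>2)) powr (- (1/2)) = 1 / sqrt (1 - t\<^sup>2)"
      using t2 by (simp add: powr_minus powr_half_sqrt field_simps)
    ultimately have "(\<lambda>k. b (2 * k) * t ^ (2 * k)) sums (1 / sqrt (1 - t\<^sup>2))"
      by simp
    moreover have "strict_mono (\<lambda>k::nat. 2 * k)"
      by (simp add: strict_mono_def)
    moreover have "b n * t ^ n = 0" if "n \<notin> range (\<lambda>k::nat. 2 * k)" for n
    proof -
      have "odd n"
        using that by (auto elim!: evenE)
      then show ?thesis by (simp add: b_def)
    qed
    ultimately show ?thesis
      using sums_mono_reindex[of "\<lambda>k::nat. 2 * k" "\<lambda>n. b n * t ^ n"] by blast
  qed
  moreover have "b n \<ge> 0" for n
    using a_pos by (simp add: b_def less_imp_le)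
  moreover have "b n > 0" if "even n" for n
    using a_pos that by (simp add: b_def)
  ultimately show ?thesis using that by blast
qed

text \<open>Termwise integration of the series for the derivative of \<open>arcsin\<close>. The
  endpoints are included because \<open>x \<bullet> y\<close> reaches 1 and -1 on the sphere, and
  \<open>summable c\<close> provides the dominating series for exchanging sum and integral.\<close>

lemma arcsin_power_series:
  obtains c :: "nat \<Rightarrow> real"
  where "\<And>n. c n \<ge> 0" and "\<And>n. odd n \<Longrightarrow> c n > 0" and "summable c"
    and "\<And>t. t \<in> {-1..1} \<Longrightarrow> (\<lambda>n. c n * t ^ n) sums arcsin t"
proof -
  obtain b :: "nat \<Rightarrow> real" where b: "\<And>n. b n \<ge> 0" "\<And>n. even n \<Longrightarrow> b n > 0"
    "\<And>t. \<bar>t\<bar> < 1 \<Longrightarrow> (\<lambda>n. b n * t ^ n) sums (1 / sqrt (1 - t\<^sup>2))"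
    using inverse_sqrt_power_series by blast
  define c where "c n = (if n = 0 then 0 else b (n - 1) / real n)" for n
  have c_nonneg: "c n \<ge> 0" for n
    using b(1) by (simp add: c_def)
  have c_pos: "c n > 0" if "odd n" for n
    using b(2)[of "n - 1"] that by (auto simp: c_def odd_pos)
  have c_Suc: "c (Suc n) * real (Suc n) = b n" for n
    by (simp add: c_def)
  define F where "F t = (\<Sum>n. c (Suc n) * t ^ Suc n)" for t
  have dF: "DERIV F t :> 1 / sqrt (1 - t\<^sup>2)" if "\<bar>t\<bar> < 1" for t
  proof -
    have "DERIV F t :> (\<Sum>n. c (Suc n) * real (Suc n) * t ^ n)"
      unfolding F_def
      by (rule DERIV_power_series'[where R = 1])
         (use that in \<open>auto simp: c_Suc abs_less_iff simp del: of_nat_Suc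
            intro!: sums_summable[OF b(3)]\<close>)
    then show ?thesis
      using b(3)[OF that] by (simp add: c_Suc sums_iff del: of_nat_Suc)
  qed
  have summ: "summable (\<lambda>n. c n * t ^ n)" if "\<bar>t\<bar> < 1" for t
  proof -
    have "summable (\<lambda>n. b n * \<bar>t\<bar> ^ n)"
      using b(3)[of "\<bar>t\<bar>"] that by (simp add: sums_iff)
    then have "summable (\<lambda>n. c (Suc n) * t ^ n)"
    proof (rule summable_comparison_test'[where N = 0])
      fix n
      have "c (Suc n) \<le> b n"
        using b(1)[of n] mult_left_mono[of 1 "1 + real n" "b n"] by (simp add: c_def divide_le_eq)
      then show "norm (c (Suc n) * t ^ n) \<le> b n * \<bar>t\<bar> ^ n"
        using c_nonneg[of "Suc n"] by (simp add: abs_mult power_abs mult_right_mono)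
    qed
    then have "summable (\<lambda>n. c (Suc n) * t ^ n * t)"
      by (rule summable_mult2)
    then have "summable (\<lambda>n. c (Suc n) * t ^ Suc n)"
      by (simp add: mult_ac)
    then show ?thesis
      using summable_Suc_iff[of "\<lambda>n. c n * t ^ n"] by blast
  qed
  have open_eq: "F t = arcsin t" if "\<bar>t\<bar> < 1" for t
  proof -
    have "F t - arcsin t = F 0 - arcsin 0"
    proof (rule DERIV_isconst3[of "-1" 1 t 0 "\<lambda>x. F x - arcsin x"])
      fix x :: real assume "x \<in> {-1<..<1}"
      then have "DERIV F x :> 1 / sqrt (1 - x\<^sup>2)" "DERIV arcsin x :> inverse (sqrt (1 - x\<^sup>2))"
        by (auto intro!: dF DERIV_arcsin)
      from DERIV_diff[OF this] show "DERIV (\<lambda>x. F x - arcsin x) x :> 0"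
        by (simp add: field_simps)
    qed (use that in auto)
    then show ?thesis by (simp add: F_def)
  qed
  have F_suminf: "F t = (\<Sum>n. c n * t ^ n)" if "\<bar>t\<bar> < 1" for t
    using suminf_split_head[OF summ[OF that]] by (simp add: F_def c_def)
  \<comment> \<open>Nonnegativity replaces a delicate endpoint argument: for
    \<open>0 < t < 1\<close> each partial sum is at most \<open>arcsin t\<close>, hence at most
    \<open>pi / 2\<close>, and \<open>t\<close> may tend to 1 in a finite sum.\<close>
  have summable_c: "summable c"
  proof (rule summableI_nonneg_bounded)
    show "(\<Sum>i<n. c i) \<le> pi / 2" for n
    proof (rule tendsto_upperbound)
      show "((\<lambda>t. \<Sum>i<n. c i * t ^ i) \<longlongrightarrow> (\<Sum>i<n. c i)) (at_left 1)"
        by (auto intro!: tendsto_eq_intros sum.cong)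
      have "eventually (\<lambda>t::real. t \<in> {0<..<1}) (at_left 1)"
        by (rule eventually_at_left_real[OF zero_less_one])
      then show "\<forall>\<^sub>F t in at_left 1. (\<Sum>i<n. c i * t ^ i) \<le> pi / 2"
      proof eventually_elim
        case (elim t)
        then have "(\<Sum>i<n. c i * t ^ i) \<le> F t"
          unfolding F_suminf[of t, simplified] using F_suminf[of t] summ[of t] c_nonneg
          by (auto intro!: sum_le_suminf)
        also have "F t \<le> pi / 2"
          using elim open_eq[of t] arcsin_ubound[of t] by auto
        finally show ?case .
      qed
    qed auto
  qed (use c_nonneg in auto)
  have "(\<lambda>n. c n * t ^ n) sums arcsin t" if t: "t \<in> {-1..1}" for t
  proof -
    have bound: "norm (c n * x ^ n) \<le> c n" if "x \<in> {-1..1}" for n x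
      using that c_nonneg[of n] power_le_one[of "\<bar>x\<bar>" n]
      by (auto simp: abs_mult power_abs intro!: mult_left_le)
    \<comment> \<open>With \<open>c\<close> itself as majorant the series is continuous up to the
      endpoints, so the identity extends from the open interval to its closure.\<close>
    have "uniform_limit {-1..1} (\<lambda>n x. \<Sum>i<n. c i * x ^ i) (\<lambda>x. \<Sum>i. c i * x ^ i) sequentially"
      by (rule Weierstrass_m_test[OF bound summable_c])
    then have "continuous_on {-1..1} (\<lambda>x. \<Sum>i. c i * x ^ i)"
      by (rule uniform_limit_theorem[rotated]) (auto intro!: always_eventually continuous_intros)
    then have cont: "continuous_on {-1..1} (\<lambda>x. (\<Sum>i. c i * x ^ i) - arcsin x)"
      by (auto intro!: continuous_intros)
    have "(\<Sum>i. c i * t ^ i) - arcsin t = 0"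
      by (rule continuous_constant_on_closure[of "{-1<..<1}"])
         (use cont t in \<open>auto simp: closure_greaterThanLessThan open_eq simp flip: F_suminf\<close>)
    moreover have "summable (\<lambda>n. c n * t ^ n)"
      using summable_c by (rule summable_comparison_test'[where N = 0]) (rule bound[OF t])
    ultimately show ?thesis by (simp add: sums_iff)
  qed
  with c_nonneg c_pos summable_c show ?thesis using that by blast
qed

section \<open>Functionals on polynomials\<close>

text \<open>Reduces a claim about all polynomials to monomials, without a normal form for
  polynomials. A monomial is a product of coordinates, with \<open>f\<close> naming the coordinate
  used by each factor.\<close>

lemma real_polynomial_functional_zero:
  fixes L :: "('a::euclidean_space \<Rightarrow> real) \<Rightarrow> real"
  assumes add: "\<And>p q. real_polynomial_function p \<Longrightarrow> real_polynomial_function q \<Longrightarrow>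
      L (\<lambda>x. p x + q x) = L p + L q"
    and scale: "\<And>c p. real_polynomial_function p \<Longrightarrow> L (\<lambda>x. c * p x) = c * L p"
    and monomial: "\<And>(m::nat) f. f \<in> {..<m} \<rightarrow> Basis \<Longrightarrow> L (\<lambda>x. \<Prod>i<m. x \<bullet> f i) = 0"
    and p: "real_polynomial_function p"
  shows "L p = 0"
proof -
  \<comment> \<open>The induction needs a stronger property: \<open>L\<close> must also kill
    \<open>q\<close> times any monomial. The aim is that \<open>Z\<close> survives multiplication by
    every polynomial; \<open>q\<close> stays arbitrary so that products of polynomials can be
    absorbed one factor at a time.\<close>
  define Z where "Z q \<longleftrightarrow> real_polynomial_function q \<and>
    (\<forall>(m::nat) f. f \<in> {..<m} \<rightarrow> Basis \<longrightarrow> L (\<lambda>x. q x * (\<Prod>i<m. x \<bullet> f i)) = 0)" for q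
  have inner: "real_polynomial_function (\<lambda>x::'a. x \<bullet> b)" for b
    by (intro real_polynomial_function.intros(1) bounded_linear_inner_left)
  have mon: "real_polynomial_function (\<lambda>x::'a. \<Prod>i<m. x \<bullet> f i)" for m :: nat and f
    by (induction m) (auto intro: inner)
  have L_sum: "real_polynomial_function (\<lambda>x. \<Sum>b\<in>B. h b x) \<and> L (\<lambda>x. \<Sum>b\<in>B. h b x) = (\<Sum>b\<in>B. L (h b))"
    if "finite B" "\<And>b. b \<in> B \<Longrightarrow> real_polynomial_function (h b)" for B :: "'a set" and h
    using that
  proof (induction B rule: finite_induct)
    case empty
    show ?case using scale[OF real_polynomial_function.intros(2), of 0 0] by auto
  qed (auto simp: add)
  have Z_mult: "Z (\<lambda>x. p x * q x)" if "real_polynomial_function p" "Z q" for p q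
    using that
  proof (induction p arbitrary: q rule: real_polynomial_function.induct)
    case (linear g)
    interpret g: bounded_linear g by fact
    have q: "real_polynomial_function q" using linear by (simp add: Z_def)
    have "L (\<lambda>x. g x * q x * (\<Prod>i<m. x \<bullet> f i)) = 0" if f: "f \<in> {..<m} \<rightarrow> Basis" for m :: nat and f
    proof -
      \<comment> \<open>A linear \<open>g\<close> is a combination of coordinates, so multiplying by
        it yields terms in which \<open>f(m := b)\<close> appends one more coordinate
        \<open>b\<close> to the monomial.\<close>
      define h where "h b x = g b * (q x * (\<Prod>i<Suc m. x \<bullet> (f(m := b)) i))" for b x
      have "L (h b) = 0" if "b \<in> Basis" for b
      proof -
        have "f(m := b) \<in> {..<Suc m} \<rightarrow> Basis"
          using f that by (auto simp: less_Suc_eq)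
        then have "L (\<lambda>x. q x * (\<Prod>i<Suc m. x \<bullet> (f(m := b)) i)) = 0"
          using \<open>Z q\<close> unfolding Z_def by blast
        then show ?thesis
          unfolding h_def by (subst scale) (auto intro!: q mon simp del: prod.lessThan_Suc)
      qed
      moreover have "real_polynomial_function (h b)" for b
        unfolding h_def by (auto intro!: q mon simp del: prod.lessThan_Suc)
      ultimately have "L (\<lambda>x. \<Sum>b\<in>Basis. h b x) = 0"
        using L_sum[of Basis h] by simp
      moreover have "(\<Sum>b\<in>Basis. h b x) = g x * q x * (\<Prod>i<m. x \<bullet> f i)" for x
      proof -
        have "g x = g (\<Sum>b\<in>Basis. (x \<bullet> b) *\<^sub>R b)"
          by (simp add: euclidean_representation)
        also have "\<dots> = (\<Sum>b\<in>Basis. (x \<bullet> b) * g b)"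
          by (simp add: g.sum g.scaleR)
        finally show ?thesis
          by (simp add: h_def sum_distrib_left mult_ac)
      qed
      ultimately show ?thesis by simp
    qed
    then show ?case
      using linear q by (auto simp: Z_def)
  next
    case (const c)
    then show ?case
      unfolding Z_def using scale by (auto simp: mult.assoc mon real_polynomial_function.intros(4))
  next
    case (add p1 p2)
    then have "Z (\<lambda>x. p1 x * q x)" "Z (\<lambda>x. p2 x * q x)"
      by blast+
    then show ?case
      by (auto simp: Z_def distrib_right mon assms(1) real_polynomial_function.intros(3,4))
  next
    case (mult p1 p2)
    have "Z (\<lambda>x. p1 x * (p2 x * q x))"
      using mult by blast
    then show ?case by (simp add: mult.assoc)
  qed
  have "Z (\<lambda>x. 1)"
    using monomial by (auto simp: Z_def)
  \<comment> \<open>The choice \<open>m = 0\<close> gives the empty product; the vector 0 in it is a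
    placeholder.\<close>
  from Z_mult[OF p this] have "L (\<lambda>x. p x * 1 * (\<Prod>i<0::nat. x \<bullet> (0::'a))) = 0"
    unfolding Z_def by (auto dest: spec[of _ 0])
  then show ?thesis by simp
qed

section \<open>Finite Borel measures are determined by continuous functions\<close>

text \<open>Indicators of closed sets are bounded limits of continuous functions, so dominated
  convergence gives agreement on closed sets, an intersection-stable generator of the Borel
  sets.\<close>

lemma finite_borel_measure_eqI_continuous:
  fixes M N :: "'a::metric_space measure"
  assumes "finite_measure M" "finite_measure N" "sets M = sets borel" "sets N = sets borel"
    and eq: "\<And>g::'a \<Rightarrow> real. continuous_on UNIV g \<Longrightarrow> bounded (range g) \<Longrightarrow>
      integral\<^sup>L M g = integral\<^sup>L N g"
  shows "M = N"
proof -
  interpret M: finite_measure M by fact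
  interpret N: finite_measure N by fact
  have closed_eq: "emeasure M C = emeasure N C" if C: "closed C" for C
  \<comment> \<open>The empty set is separate because \<open>infdist x {}\<close> is 0 by
    convention: the functions \<open>g n\<close> would then be constantly 1.\<close>
  proof (cases "C = {}")
    case False
    define g where "g n x = max 0 (1 - real n * infdist x C)" for n :: nat and x
    have cont: "continuous_on UNIV (g n)" for n
      unfolding g_def by (intro continuous_intros)
    have g_bound: "\<bar>g n x\<bar> \<le> 1" for n x
      using infdist_nonneg[of x C] by (simp add: g_def)
    have lim: "(\<lambda>n. g n x) \<longlonglongrightarrow> indicator C x" for x
    proof (cases "x \<in> C")
      case True
      then show ?thesis by (simp add: g_def)
    next
      case x: False
      then have d: "infdist x C > 0"
        using C False by (simp add: infdist_pos_not_in_closed)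
      obtain k where k: "inverse (infdist x C) < real k"
        using reals_Archimedean2 by blast
      have "g n x = 0" if "n \<ge> k" for n
      proof -
        have "1 \<le> real n * infdist x C"
          using k d that by (simp add: field_simps) (smt (verit) mult_right_mono of_nat_mono)
        then show ?thesis by (simp add: g_def)
      qed
      then have "(\<lambda>n. g n x) \<longlonglongrightarrow> 0"
        by (intro tendsto_eventually) (auto simp: eventually_sequentially)
      then show ?thesis using x by simp
    qed
    have meas: "(\<lambda>n. integral\<^sup>L K (g n)) \<longlonglongrightarrow> measure K C"
      if "finite_measure K" "sets K = sets borel" for K
    proof -
      interpret K: finite_measure K by fact
      have [measurable]: "C \<in> sets K" using C that by simp
      have [measurable]: "g n \<in> borel_measurable K" for n
        using borel_measurable_continuous_onI[OF cont] measurable_cong_sets[OF that(2) refl] by blast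
      have "(\<lambda>n. integral\<^sup>L K (g n)) \<longlonglongrightarrow> integral\<^sup>L K (indicator C)"
        by (rule integral_dominated_convergence[where w = "\<lambda>_. 1"])
           (use lim g_bound in auto)
      then show ?thesis by simp
    qed
    have "integral\<^sup>L M (g n) = integral\<^sup>L N (g n)" for n
      using g_bound cont by (intro eq) (auto simp: bounded_iff)
    then have "measure M C = measure N C"
      using LIMSEQ_unique meas[of M] meas[of N] assms by auto
    then show ?thesis by (simp add: M.emeasure_eq_measure N.emeasure_eq_measure)
  qed simp
  show ?thesis
  proof (rule measure_eqI_generator_eq[where E = "Collect closed" and \<Omega> = UNIV and A = "\<lambda>_. UNIV"])
    show "Int_stable (Collect closed)"
      by (auto simp: Int_stable_def)
    show "sets M = sigma_sets UNIV (Collect closed)" "sets N = sigma_sets UNIV (Collect closed)"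
      by (simp_all add: assms borel_eq_closed)
  qed (auto simp: closed_eq)
qed

section \<open>Probability measures on the sphere\<close>

text \<open>Packages membership in \<open>sphere_prob_measures\<close>, so that the bounds can be
  used for the given measure and for every competitor in the supremum.\<close>

locale sphere_prob_space = prob_space \<mu> for \<mu> :: "(real ^ 'n) measure" +
  assumes sets_eq: "sets \<mu> = sets (restrict_space borel (sphere 0 1))"
begin

lemma space_eq: "space \<mu> = sphere 0 1"
  using sets_eq_imp_space_eq[OF sets_eq] by (simp add: space_restrict_space)

lemma sets_iff: "E \<in> sets \<mu> \<longleftrightarrow> E \<subseteq> sphere 0 1 \<and> E \<in> sets borel"
  unfolding sets_eq by (rule sets_restrict_space_iff) simp

lemma borel_measurable_continuous:
  "continuous_on (sphere 0 1) f \<Longrightarrow> f \<in> borel_measurable \<mu>"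
  using borel_measurable_continuous_on_restrict measurable_cong_sets[OF sets_eq refl] by blast

lemma integrable_continuous:
  fixes f :: "real ^ 'n \<Rightarrow> real"
  assumes "continuous_on (sphere 0 1) f"
  shows "integrable \<mu> f"
proof -
  have "bounded (f ` sphere 0 1)"
    using assms by (intro compact_imp_bounded compact_continuous_image) auto
  then obtain B where "\<And>x. x \<in> sphere 0 1 \<Longrightarrow> norm (f x) \<le> B"
    unfolding bounded_iff by blast
  then show ?thesis
    using borel_measurable_continuous[OF assms]
    by (intro integrable_const_bound[where B = B]) (auto simp: space_eq)
qed

lemma integrable_continuous_uminus:
  fixes f :: "real ^ 'n \<Rightarrow> real"
  assumes "continuous_on (sphere 0 1) f"
  shows "integrable \<mu> (\<lambda>x. f (- x))"
  by (rule integrable_continuous, rule continuous_on_compose2[OF assms]) (auto intro: continuous_intros)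

lemma measurable_uminus_sphere: "uminus \<in> measurable \<mu> \<mu>"
proof -
  have "uminus \<in> measurable (restrict_space borel (sphere 0 1)) (restrict_space borel (sphere (0 :: real ^ 'n) 1))"
    by (intro measurable_restrict_space3) auto
  then show ?thesis
    using measurable_cong_sets[OF sets_eq sets_eq] by blast
qed

lemma inner_sphere: "x \<in> space \<mu> \<Longrightarrow> y \<in> space \<mu> \<Longrightarrow> x \<bullet> y \<in> {-1..1}"
  using Cauchy_Schwarz_ineq2[of x y] by (auto simp: space_eq abs_le_iff)

section \<open>The product measure and the moment expansion of the energy\<close>

sublocale pair: pair_prob_space \<mu> \<mu> ..

lemma integrable_inner_kernel:
  fixes \<phi> :: "real \<Rightarrow> real"
  assumes "continuous_on {-1..1} \<phi>"
  shows "integrable (\<mu> \<Otimes>\<^sub>M \<mu>) (\<lambda>(x, y). \<phi> (x \<bullet> y))"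
proof -
  have id: "(\<lambda>x. x) \<in> borel_measurable \<mu>"
    by (intro borel_measurable_continuous continuous_intros)
  have inner: "(\<lambda>z. fst z \<bullet> snd z) \<in> borel_measurable (\<mu> \<Otimes>\<^sub>M \<mu>)"
    by (intro borel_measurable_inner measurable_compose[OF measurable_fst id]
          measurable_compose[OF measurable_snd id])
  \<comment> \<open>Clamping the argument to the interval extends the kernel continuously to the
    whole line; inner products of unit vectors are unaffected by it.\<close>
  have "continuous_on UNIV (\<lambda>t. \<phi> (max (-1) (min 1 t)))"
    by (rule continuous_on_compose2[OF assms]) (auto intro!: continuous_intros)
  then have "(\<lambda>t. \<phi> (max (-1) (min 1 t))) \<in> borel_measurable borel"
    by (rule borel_measurable_continuous_onI)
  from measurable_compose[OF inner this]
  have meas: "(\<lambda>(x, y). \<phi> (x \<bullet> y)) \<in> borel_measurable (\<mu> \<Otimes>\<^sub>M \<mu>)"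
  proof (rule measurable_cong[THEN iffD1, rotated])
    fix z assume "z \<in> space (\<mu> \<Otimes>\<^sub>M \<mu>)"
    then show "\<phi> (max (- 1) (min 1 (fst z \<bullet> snd z))) = (case z of (x, y) \<Rightarrow> \<phi> (x \<bullet> y))"
      using inner_sphere[of "fst z" "snd z"] by (auto simp: space_pair_measure)
  qed
  have "bounded (\<phi> ` {-1..1})"
    using assms by (intro compact_imp_bounded compact_continuous_image) auto
  then obtain B where "\<And>t. t \<in> {-1..1} \<Longrightarrow> norm (\<phi> t) \<le> B"
    unfolding bounded_iff by blast
  with meas inner_sphere show ?thesis
    by (intro pair.integrable_const_bound[where B = B]) (fastforce simp: space_pair_measure)+
qed

lemma integral_inner_kernel:
  fixes \<phi> :: "real \<Rightarrow> real"
  assumes "continuous_on {-1..1} \<phi>"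
  shows "(LINT y|\<mu>. (LINT x|\<mu>. \<phi> (x \<bullet> y))) = (LINT (x, y)|(\<mu> \<Otimes>\<^sub>M \<mu>). \<phi> (x \<bullet> y))"
  by (rule pair.integral_snd) (rule integrable_inner_kernel[OF assms])

text \<open>Multiplying out the power separates the variables: each term is a monomial in
  \<open>x\<close> times the same monomial in \<open>y\<close>, so it integrates to a square.
  Summing over ordered choices \<open>f\<close> avoids multinomial coefficients.\<close>

lemma integral_inner_power:
  "(LINT (x, y)|(\<mu> \<Otimes>\<^sub>M \<mu>). (x \<bullet> y) ^ m) =
     (\<Sum>f\<in>{..<m} \<rightarrow>\<^sub>E Basis. (LINT x|\<mu>. (\<Prod>i<m. x \<bullet> f i))\<^sup>2)"
proof -
  let ?F = "{..<m} \<rightarrow>\<^sub>E (Basis :: (real ^ 'n) set)"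
  have expand: "(x \<bullet> y) ^ m = (\<Sum>f\<in>?F. (\<Prod>i<m. y \<bullet> f i) * (\<Prod>i<m. x \<bullet> f i))"
    for x y :: "real ^ 'n"
  proof -
    have "(x \<bullet> y) ^ m = (\<Prod>i<m. \<Sum>b\<in>Basis. (y \<bullet> b) * (x \<bullet> b))"
      by (subst euclidean_inner) (simp add: mult.commute)
    also have "\<dots> = (\<Sum>f\<in>?F. \<Prod>i<m. (y \<bullet> f i) * (x \<bullet> f i))"
      by (rule prod_sum_PiE) auto
    finally show ?thesis by (simp add: prod.distrib)
  qed
  have int: "integrable \<mu> (\<lambda>x. \<Prod>i<m. x \<bullet> f i)" for f
    by (intro integrable_continuous continuous_intros)
  have "(LINT (x, y)|(\<mu> \<Otimes>\<^sub>M \<mu>). (x \<bullet> y) ^ m) = (LINT y|\<mu>. (LINT x|\<mu>. (x \<bullet> y) ^ m))"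
    by (rule integral_inner_kernel[symmetric]) (intro continuous_intros)
  then show ?thesis
    unfolding expand by (simp add: int power2_eq_square)
qed

text \<open>Passing from \<open>arccos\<close> to \<open>arcsin\<close> isolates the constant 1/2
  and leaves a kernel whose power series has nonnegative coefficients.\<close>

lemma geodesic_energy_eq:
  "geodesic_energy \<mu> = 1 / 2 - (LINT (x, y)|(\<mu> \<Otimes>\<^sub>M \<mu>). arcsin (x \<bullet> y)) / pi"
proof -
  have "geodesic_energy \<mu> = (LINT y|\<mu>. (LINT x|\<mu>. arccos (x \<bullet> y) / pi))"
    by (simp add: geodesic_energy_def geodesic_dist_def)
  also have "\<dots> = (LINT (x, y)|(\<mu> \<Otimes>\<^sub>M \<mu>). arccos (x \<bullet> y) / pi)"
    by (rule integral_inner_kernel) (intro continuous_intros, auto)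
  also have "\<dots> = (LINT z|(\<mu> \<Otimes>\<^sub>M \<mu>). 1 / 2 - (case z of (x, y) \<Rightarrow> arcsin (x \<bullet> y)) / pi)"
  proof (rule Bochner_Integration.integral_cong[OF refl], clarify)
    fix x y assume "(x, y) \<in> space (\<mu> \<Otimes>\<^sub>M \<mu>)"
    then have "x \<bullet> y \<in> {-1..1}"
      by (simp add: space_pair_measure inner_sphere del: atLeastAtMost_iff)
    then show "arccos (x \<bullet> y) / pi = 1 / 2 - arcsin (x \<bullet> y) / pi"
      by (simp add: arccos_arcsin_eq field_simps)
  qed
  also have "\<dots> = 1 / 2 - (LINT (x, y)|(\<mu> \<Otimes>\<^sub>M \<mu>). arcsin (x \<bullet> y)) / pi"
    using integrable_inner_kernel[OF continuous_on_arcsin'] by (simp add: pair.prob_space)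
  finally show ?thesis .
qed

text \<open>Sum and integral may be exchanged because inner products of unit vectors are at most 1
  in absolute value, so the \<open>n\<close>-th term is dominated by \<open>c n\<close>.\<close>

lemma integral_arcsin_sums:
  assumes c: "\<And>n. c n \<ge> 0" "summable c" "\<And>t. t \<in> {-1..1} \<Longrightarrow> (\<lambda>n. c n * t ^ n) sums arcsin t"
  shows "(\<lambda>n. c n * (LINT (x, y)|(\<mu> \<Otimes>\<^sub>M \<mu>). (x \<bullet> y) ^ n)) sums (LINT (x, y)|(\<mu> \<Otimes>\<^sub>M \<mu>). arcsin (x \<bullet> y))"
proof -
  define h where "h n z = c n * (case z of (x, y) \<Rightarrow> (x \<bullet> y) ^ n)" for n and z :: "(real ^ 'n) \<times> (real ^ 'n)"
  have int: "integrable (\<mu> \<Otimes>\<^sub>M \<mu>) (h n)" for n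
    unfolding h_def
    by (intro integrable_mult_right integrable_inner_kernel continuous_intros)
  have bound: "norm (h n z) \<le> c n" if "z \<in> space (\<mu> \<Otimes>\<^sub>M \<mu>)" for n z
  proof -
    have "\<bar>fst z \<bullet> snd z\<bar> \<le> 1"
      using that inner_sphere[of "fst z" "snd z"] by (auto simp: space_pair_measure)
    then show ?thesis
      using c(1)[of n] power_le_one[of "\<bar>fst z \<bullet> snd z\<bar>" n]
      by (auto simp: h_def abs_mult power_abs case_prod_unfold intro!: mult_left_le)
  qed
  have "(\<lambda>n. integral\<^sup>L (\<mu> \<Otimes>\<^sub>M \<mu>) (h n)) sums (LINT z|(\<mu> \<Otimes>\<^sub>M \<mu>). (\<Sum>n. h n z))"
  proof (rule sums_integral[OF int])
    show "AE z in \<mu> \<Otimes>\<^sub>M \<mu>. summable (\<lambda>n. norm (h n z))"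
    proof (rule AE_I2)
      fix z assume "z \<in> space (\<mu> \<Otimes>\<^sub>M \<mu>)"
      then show "summable (\<lambda>n. norm (h n z))"
        using bound by (intro summable_comparison_test'[OF c(2), where N = 0]) simp
    qed
    have "(LINT z|(\<mu> \<Otimes>\<^sub>M \<mu>). norm (h n z)) \<le> (LINT z|(\<mu> \<Otimes>\<^sub>M \<mu>). c n)" for n
      by (rule integral_mono) (use int bound in auto)
    then show "summable (\<lambda>n. LINT z|(\<mu> \<Otimes>\<^sub>M \<mu>). norm (h n z))"
      by (intro summable_comparison_test'[OF c(2), where N = 0]) (simp add: pair.prob_space)
  qed
  moreover have "(LINT z|(\<mu> \<Otimes>\<^sub>M \<mu>). (\<Sum>n. h n z)) = (LINT (x, y)|(\<mu> \<Otimes>\<^sub>M \<mu>). arcsin (x \<bullet> y))"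
  proof (rule Bochner_Integration.integral_cong[OF refl], clarify)
    fix x y assume "(x, y) \<in> space (\<mu> \<Otimes>\<^sub>M \<mu>)"
    then have "x \<bullet> y \<in> {-1..1}"
      by (simp add: space_pair_measure inner_sphere del: atLeastAtMost_iff)
    from sums_unique[OF c(3)[OF this]] show "(\<Sum>n. h n (x, y)) = arcsin (x \<bullet> y)"
      by (simp add: h_def)
  qed
  moreover have "integral\<^sup>L (\<mu> \<Otimes>\<^sub>M \<mu>) (h n) = c n * (LINT (x, y)|(\<mu> \<Otimes>\<^sub>M \<mu>). (x \<bullet> y) ^ n)" for n
    unfolding h_def by (rule integral_mult_right_zero)
  ultimately show ?thesis by simp
qed

lemma integral_inner_power_nonneg: "(LINT (x, y)|(\<mu> \<Otimes>\<^sub>M \<mu>). (x \<bullet> y) ^ n) \<ge> 0"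
  unfolding integral_inner_power by (simp add: sum_nonneg)

lemma geodesic_energy_le: "geodesic_energy \<mu> \<le> 1 / 2"
proof -
  obtain c :: "nat \<Rightarrow> real" where c: "\<And>n. c n \<ge> 0" "summable c"
    "\<And>t. t \<in> {-1..1} \<Longrightarrow> (\<lambda>n. c n * t ^ n) sums arcsin t"
    using arcsin_power_series by metis
  have "(LINT (x, y)|(\<mu> \<Otimes>\<^sub>M \<mu>). arcsin (x \<bullet> y)) \<ge> 0"
    using sums_le[OF _ sums_zero integral_arcsin_sums[OF c]] c(1) integral_inner_power_nonneg by simp
  then show ?thesis by (simp add: geodesic_energy_eq)
qed

section \<open>Maximal energy forces central symmetry\<close>

text \<open>Maximal energy makes a series of nonnegative terms sum to 0, so every term vanishes. For
  odd \<open>m\<close> the coefficient is positive, hence the sum of squared moments of order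
  \<open>m\<close> is 0.\<close>

lemma odd_moment_zero:
  fixes m :: nat
  assumes "geodesic_energy \<mu> = 1 / 2" "odd m" "f \<in> {..<m} \<rightarrow> Basis"
  shows "(LINT x|\<mu>. (\<Prod>i<m. x \<bullet> f i)) = 0"
proof -
  obtain c :: "nat \<Rightarrow> real" where c: "\<And>n. c n \<ge> 0" "\<And>n. odd n \<Longrightarrow> c n > 0" "summable c"
    "\<And>t. t \<in> {-1..1} \<Longrightarrow> (\<lambda>n. c n * t ^ n) sums arcsin t"
    using arcsin_power_series by blast
  define J where "J n = (LINT (x, y)|(\<mu> \<Otimes>\<^sub>M \<mu>). (x \<bullet> y) ^ n)" for n :: nat
  have "(\<lambda>n. c n * J n) sums 0"
    using integral_arcsin_sums[OF c(1,3,4)] assms(1) by (simp add: geodesic_energy_eq J_def)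
  moreover have "c n * J n \<ge> 0" for n
    using c(1) integral_inner_power_nonneg by (simp add: J_def)
  ultimately have "c m * J m = 0"
    using suminf_eq_zero_iff[of "\<lambda>n. c n * J n"] by (auto simp: sums_iff)
  then have "J m = 0"
    using c(2)[OF assms(2)] by simp
  then have "\<forall>g\<in>{..<m} \<rightarrow>\<^sub>E Basis. (LINT x|\<mu>. (\<Prod>i<m. x \<bullet> g i))\<^sup>2 = 0"
    unfolding J_def integral_inner_power
    by (subst (asm) sum_nonneg_eq_0_iff) (auto intro: finite_PiE)
  \<comment> \<open>The squares are indexed by extensional functions; restricting \<open>f\<close>
    does not change the product over \<open>i < m\<close>.\<close>
  moreover have "restrict f {..<m} \<in> {..<m} \<rightarrow>\<^sub>E Basis"
    using assms(3) by (simp add: PiE_iff Pi_iff)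
  ultimately have "(LINT x|\<mu>. (\<Prod>i<m. x \<bullet> restrict f {..<m} i))\<^sup>2 = 0"
    by (rule bspec)
  then show ?thesis by simp
qed

text \<open>The functional sending \<open>q\<close> to the difference of the two integrals kills
  monomials: even ones are invariant under reflection, odd ones have integral 0.\<close>

lemma integral_uminus_polynomial:
  assumes "geodesic_energy \<mu> = 1 / 2" "real_polynomial_function p"
  shows "(LINT x|\<mu>. p x) = (LINT x|\<mu>. p (- x))"
proof -
  have int: "integrable \<mu> q" "integrable \<mu> (\<lambda>x. q (- x))" if "real_polynomial_function q" for q
  proof -
    have "continuous_on A q" for A
      using that by (simp add: continuous_on_polymonial_function real_polynomial_function_eq)
    then show "integrable \<mu> q" "integrable \<mu> (\<lambda>x. q (- x))"
      by (auto intro: integrable_continuous integrable_continuous_uminus)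
  qed
  have "(LINT x|\<mu>. p x) - (LINT x|\<mu>. p (- x)) = 0"
  proof (rule real_polynomial_functional_zero[where L = "\<lambda>q. (LINT x|\<mu>. q x) - (LINT x|\<mu>. q (- x))"])
    fix m :: nat and f assume f: "f \<in> {..<m} \<rightarrow> (Basis :: (real ^ 'n) set)"
    have "(\<Prod>i<m. - x \<bullet> f i) = (- 1) ^ m * (\<Prod>i<m. x \<bullet> f i)" for x
      by (simp add: prod_uminus)
    then show "(LINT x|\<mu>. (\<Prod>i<m. x \<bullet> f i)) - (LINT x|\<mu>. (\<Prod>i<m. - x \<bullet> f i)) = 0"
      using odd_moment_zero[OF assms(1) _ f] by (cases "even m") simp_all
  qed (use int assms(2) in \<open>simp_all add: algebra_simps\<close>)
  then show ?thesis by simp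
qed

lemma integral_uminus_continuous:
  fixes g :: "real ^ 'n \<Rightarrow> real"
  assumes "geodesic_energy \<mu> = 1 / 2" "continuous_on (sphere 0 1) g"
  shows "(LINT x|\<mu>. g x) = (LINT x|\<mu>. g (- x))"
proof -
  have g_int: "integrable \<mu> g" "integrable \<mu> (\<lambda>x. g (- x))"
    using assms(2)
    by (auto intro: integrable_continuous integrable_continuous_uminus)
  \<comment> \<open>The form \<open>0 + e\<close> is the one expected by
    \<open>field_le_epsilon\<close>.\<close>
  have "\<bar>(LINT x|\<mu>. g x) - (LINT x|\<mu>. g (- x))\<bar> \<le> 0 + e" if "e > 0" for e
  proof -
    obtain p where p: "real_polynomial_function p" "\<And>x. x \<in> sphere 0 1 \<Longrightarrow> \<bar>g x - p x\<bar> < e / 2"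
      using Stone_Weierstrass_real_polynomial_function[OF compact_sphere assms(2), of "e / 2"] \<open>e > 0\<close>
      by auto
    have "continuous_on A p" for A
      using p(1) by (simp add: continuous_on_polymonial_function real_polynomial_function_eq)
    then have p_int: "integrable \<mu> p" "integrable \<mu> (\<lambda>x. p (- x))"
      by (auto intro: integrable_continuous integrable_continuous_uminus)
    have close: "\<bar>(LINT x|\<mu>. u x) - (LINT x|\<mu>. v x)\<bar> \<le> e / 2"
      if "integrable \<mu> u" "integrable \<mu> v" "\<And>x. x \<in> sphere 0 1 \<Longrightarrow> \<bar>u x - v x\<bar> < e / 2" for u v
    proof -
      have "\<bar>LINT x|\<mu>. u x - v x\<bar> \<le> (LINT x|\<mu>. \<bar>u x - v x\<bar>)"
        by (rule integral_abs_bound)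
      also have "\<dots> \<le> (LINT x|\<mu>. e / 2)"
        using that by (intro integral_mono) (auto simp: space_eq less_imp_le)
      finally show ?thesis
        using that by (simp add: prob_space)
    qed
    have "\<bar>(LINT x|\<mu>. g x) - (LINT x|\<mu>. p x)\<bar> \<le> e / 2"
      by (rule close) (use g_int p_int p in auto)
    \<comment> \<open>The same \<open>p\<close> serves for the reflected functions, since the sphere
      is closed under negation.\<close>
    moreover have "\<bar>(LINT x|\<mu>. g (- x)) - (LINT x|\<mu>. p (- x))\<bar> \<le> e / 2"
      by (rule close) (use g_int p_int p in auto)
    ultimately show ?thesis
      using integral_uminus_polynomial[OF assms(1) p(1)] by linarith
  qed
  then have "\<bar>(LINT x|\<mu>. g x) - (LINT x|\<mu>. g (- x))\<bar> \<le> 0"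
    by (rule field_le_epsilon)
  then show ?thesis by simp
qed

lemma vimage_uminus_sphere:
  fixes E :: "(real ^ 'n) set"
  assumes "E \<subseteq> sphere 0 1"
  shows "uminus -` E \<inter> space \<mu> = uminus ` E"
  using assms by (force simp: space_eq image_iff)

lemma centrally_symmetric_if_max_energy:
  assumes "geodesic_energy \<mu> = 1 / 2"
  shows "centrally_symmetric \<mu>"
  unfolding centrally_symmetric_def
proof safe
  fix E :: "(real ^ 'n) set" assume E: "E \<in> sets borel" "E \<subseteq> sphere 0 1"
  have [measurable]: "(\<lambda>x. x) \<in> borel_measurable \<mu>" "uminus \<in> borel_measurable \<mu>"
    by (intro borel_measurable_continuous continuous_intros)+
  \<comment> \<open>Pushing forward along the identity moves the measure to the ambient space, where
    the criterion for Borel measures applies; the other side is its reflection.\<close>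
  have "distr \<mu> borel (\<lambda>x. x) = distr \<mu> borel uminus"
  proof (rule finite_borel_measure_eqI_continuous)
    fix g :: "real ^ 'n \<Rightarrow> real" assume g: "continuous_on UNIV g"
    have [measurable]: "g \<in> borel_measurable borel"
      using g by (rule borel_measurable_continuous_onI)
    have "(LINT x|\<mu>. g x) = (LINT x|\<mu>. g (- x))"
      using integral_uminus_continuous[OF assms] g continuous_on_subset by blast
    then show "integral\<^sup>L (distr \<mu> borel (\<lambda>x. x)) g = integral\<^sup>L (distr \<mu> borel uminus) g"
      by (simp add: integral_distr)
  qed (auto intro!: finite_measure_distr)
  then have "emeasure (distr \<mu> borel (\<lambda>x. x)) E = emeasure (distr \<mu> borel uminus) E"
    by simp
  then show "emeasure \<mu> E = emeasure \<mu> (uminus ` E)"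
    using E by (simp add: emeasure_distr vimage_uminus_sphere) (simp add: space_eq Int_absorb2)
qed

section \<open>Central symmetry gives maximal energy\<close>

lemma max_energy_if_centrally_symmetric:
  assumes "centrally_symmetric \<mu>"
  shows "geodesic_energy \<mu> = 1 / 2"
proof -
  have distr: "distr \<mu> \<mu> uminus = \<mu>"
  proof (rule measure_eqI)
    fix E assume "E \<in> sets (distr \<mu> \<mu> uminus)"
    then have "E \<in> sets \<mu>" "E \<subseteq> sphere 0 1" "E \<in> sets borel"
      by (simp_all add: sets_iff)
    then show "emeasure (distr \<mu> \<mu> uminus) E = emeasure \<mu> E"
      using assms
      by (simp add: emeasure_distr measurable_uminus_sphere vimage_uminus_sphere centrally_symmetric_def)
  qed simp
  have "(LINT x|\<mu>. geodesic_dist x y) = 1 / 2" if y: "y \<in> space \<mu>" for y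
  proof -
    have cont: "continuous_on (sphere 0 1) (\<lambda>x. geodesic_dist x y)"
      unfolding geodesic_dist_def
      by (rule continuous_on_divide[OF continuous_on_compose2[OF continuous_on_arccos']])
         (use inner_sphere[OF _ y] in \<open>auto simp: space_eq intro!: continuous_intros\<close>)
    \<comment> \<open>Reflecting the variable replaces the distance by 1 minus itself, so the
      potential \<open>u\<close> at \<open>y\<close> satisfies \<open>u = 1 - u\<close>.\<close>
    have "(LINT x|\<mu>. geodesic_dist x y) = (LINT x|distr \<mu> \<mu> uminus. geodesic_dist x y)"
      by (simp add: distr)
    also have "\<dots> = (LINT x|\<mu>. geodesic_dist (- x) y)"
      by (rule integral_distr[OF measurable_uminus_sphere borel_measurable_continuous[OF cont]])
    also have "\<dots> = (LINT x|\<mu>. 1 - geodesic_dist x y)"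
    proof (rule Bochner_Integration.integral_cong[OF refl])
      fix x assume "x \<in> space \<mu>"
      then show "geodesic_dist (- x) y = 1 - geodesic_dist x y"
        using inner_sphere[OF _ y] by (simp add: geodesic_dist_def arccos_minus field_simps)
    qed
    also have "\<dots> = 1 - (LINT x|\<mu>. geodesic_dist x y)"
      using integrable_continuous[OF cont] by (simp add: prob_space)
    finally show ?thesis by simp
  qed
  then have "geodesic_energy \<mu> = (LINT y|\<mu>. 1 / 2)"
    unfolding geodesic_energy_def by (intro Bochner_Integration.integral_cong) auto
  then show ?thesis by (simp add: prob_space)
qed

end

theorem theorem4p11:
  fixes d :: nat and \<mu> :: "(real ^ 'n) measure"
  assumes "d \<ge> 1" and "CARD('n) = d + 1"
    and "\<mu> \<in> sphere_prob_measures"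
  shows "(geodesic_energy \<mu> =
            (SUP \<gamma>\<in>(sphere_prob_measures :: (real ^ 'n) measure set). geodesic_energy \<gamma>)
          \<and> (SUP \<gamma>\<in>(sphere_prob_measures :: (real ^ 'n) measure set). geodesic_energy \<gamma>) = 1 / 2)
         \<longleftrightarrow> centrally_symmetric \<mu>"
proof -
  have sphere: "sphere_prob_space \<gamma>" if "\<gamma> \<in> sphere_prob_measures" for \<gamma> :: "(real ^ 'n) measure"
    using that
    by (simp add: sphere_prob_measures_def sphere_prob_space_def sphere_prob_space_axioms_def)
  interpret sphere_prob_space \<mu>
    by (rule sphere) fact
  show ?thesis
  proof
    assume "centrally_symmetric \<mu>"
    then have energy: "geodesic_energy \<mu> = 1 / 2"
      by (rule max_energy_if_centrally_symmetric)
    \<comment> \<open>The given measure attains the bound 1/2 that holds for all competitors, so the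
      supremum is a maximum.\<close>
    moreover have "(SUP \<gamma>\<in>(sphere_prob_measures :: (real ^ 'n) measure set). geodesic_energy \<gamma>) = 1 / 2"
      by (rule cSup_eq_maximum)
         (use assms(3) energy sphere_prob_space.geodesic_energy_le[OF sphere] in \<open>auto intro: rev_image_eqI\<close>)
    ultimately show "geodesic_energy \<mu> =
            (SUP \<gamma>\<in>(sphere_prob_measures :: (real ^ 'n) measure set). geodesic_energy \<gamma>)
          \<and> (SUP \<gamma>\<in>(sphere_prob_measures :: (real ^ 'n) measure set). geodesic_energy \<gamma>) = 1 / 2"
      by simp
  qed (use centrally_symmetric_if_max_energy in simp)
qed

end
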